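(* Let the training set $\mathcal{D}_{train}$ have the long-tailed label distribution $\mathbb{P}(Y=y_i)=\frac{\lambda}{e^{-\lambda}-e^{-\lambda C}}\,e^{-\lambda y_i}$, $y_i\in[1,C]$, where $\lambda=\frac{\ln\rho}{C-1}$. When the mixing factor is the UniMix Factor $\xi^*_{i,j}\sim\mathscr{U}(\pi_{y_i},\pi_{y_j},\alpha,\alpha)$, $\alpha\in[0,1]$, the newly mixed dataset $\mathcal{D}_\nu$ composed of $\xi$-Aug samples $(\tilde x_{i,j},\tilde y_{i,j})$, where $(x_i,y_i)$ and $(x_j,y_j)$ are both randomly sampled from $\mathcal{D}_{train}$, follows a middle-majority distribution: $$\mathbb{P}^*_{mixup}(Y^*=y_i)=\mathbb{P}(Y=y_i)\int_{y_j<y_i}\mathbf{1}\!\left(\int\xi^*_{i,j}\,\mathscr{U}(\pi_{y_i},\pi_{y_j},\alpha,\alpha)\,d\xi^*_{i,j}\ge 0.5\right)\mathbb{P}(Y=y_j)\,dy_j$$ $$=\frac{\lambda}{\left(e^{-\lambda}-e^{-\lambda C}\right)^2}\left(e^{-\lambda(y_i+1)}-e^{-2\lambda y_i}\right),\qquad y_i\in[1,C].$$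
   Context: $C$ is the number of classes. Classes are indexed in decreasing order of their number of instances, and the class index is treated as a continuous variable in $[1,C]$. $\rho$ is the imbalance factor of the training set: the number of instances of the most frequent class (index $1$) divided by that of the least frequent class (index $C$). $\mathbb{P}(Y=y)$ is the probability of class $y$ in $\mathcal{D}_{train}$, and $\pi_y=\mathbb{P}(Y=y)$ is the training prior of class $y$. Let $f(\cdot;\alpha,\alpha)$ be the density of $Beta(\alpha,\alpha)$. For priors $\pi_{y_i},\pi_{y_j}$ put $c=\frac{\pi_{y_j}}{\pi_{y_i}+\pi_{y_j}}$. The density $\mathscr{U}(\pi_{y_i},\pi_{y_j},\alpha,\alpha)$ of the UniMix Factor on $[0,1]$ takes the value $f(\xi^*_{i,j}-c+1;\alpha,\alpha)$ for $\xi^*_{i,j}\in[0,c)$ and $f(\xi^*_{i,j}-c;\alpha,\alpha)$ for $\xi^*_{i,j}\in[c,1]$. The mixed samples are $\tilde x_{i,j}=\xi^*_{i,j}x_i+(1-\xi^*_{i,j})x_j$, $\tilde y_{i,j}=\xi^*_{i,j}y_i+(1-\xi^*_{i,j})y_j$. A virtual sample mixed in this way with factor $\xi$ is called a $\xi$-Aug sample; it is a (robust) sample of class $y_i$ iff $\xi\ge0.5$ and of class $y_j$ iff $\xi<0.5$, meaning that it contributes to that class in the model's feature learning. For the random UniMix Factor, whether $\tilde x_{i,j}$ counts as a sample of class $y_i$ is decided by whether the mean of $\xi^*_{i,j}$ is at least $0.5$. $\mathbb{P}^*_{mixup}(Y^*=y_i)$ is the probability that $\tilde x_{i,j}$ belongs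 to class $y_i$. $\mathbf{1}(\cdot)$ is the indicator of a condition. "Middle-majority" means that most data concentrates on the middle classes; this is read off from the formula by finding a zero of its derivative in the range $[1,C]$.
   Formalization: The derivative has a zero in [1,C] only if ρ≥2 (assumed), with an interior peak for ρ>2; at α=1 every mixed sample counts as y_i, so only draws with y_j<y_i are counted there; Beta(0,0) is read as the limit α→0; C≥2 and ρ>1 are assumed. *)

theory Defs
  imports "HOL-Probability.Probability"
begin

text \<open>
  Classes form a continuum \<open>{1..C}\<close>, so "the probability of class \<open>y\<close>" is throughout a density with
  respect to Lebesgue measure.
\<close>

definition longtail_prior :: "real \<Rightarrow> real \<Rightarrow> real \<Rightarrow> real" where
  "longtail_prior lam C y =
     (if 1 \<le> y \<and> y \<le> C then lam / (exp (- lam) - exp (- lam * C)) * exp (- lam * y) else 0)"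

text \<open>With \<open>lam = ln \<rho> / (C - 1)\<close> the parameter \<open>\<rho>\<close> is indeed the imbalance factor.\<close>

lemma longtail_prior_imbalance:
  fixes \<rho> C lam :: real
  assumes "1 < C" "1 < \<rho>" "lam = ln \<rho> / (C - 1)"
  shows "longtail_prior lam C 1 / longtail_prior lam C C = \<rho>"
proof -
  have pos: "0 < lam" using assms by simp
  have "exp (- lam) - exp (- lam * C) \<noteq> 0"
    using pos assms(1) by simp
  moreover have "exp (- lam) / exp (- lam * C) = exp (lam * (C - 1))"
    by (simp add: exp_diff [symmetric] algebra_simps)
  moreover have "lam * (C - 1) = ln \<rho>" using assms by simp
  ultimately show ?thesis using pos assms by (simp add: longtail_prior_def)
qed

definition beta_density :: "real \<Rightarrow> real \<Rightarrow> real \<Rightarrow> real" where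
  "beta_density a b x =
     (if 0 < x \<and> x < 1 then x powr (a - 1) * (1 - x) powr (b - 1) / Beta a b else 0)"

definition unimix_shift :: "real \<Rightarrow> real \<Rightarrow> real" where
  "unimix_shift \<pi>i \<pi>j = \<pi>j / (\<pi>i + \<pi>j)"

definition unimix_density :: "real \<Rightarrow> real \<Rightarrow> real \<Rightarrow> real \<Rightarrow> real" where
  "unimix_density \<pi>i \<pi>j \<alpha> \<xi> =
     (let c = unimix_shift \<pi>i \<pi>j in
        if 0 \<le> \<xi> \<and> \<xi> < c then beta_density \<alpha> \<alpha> (\<xi> - c + 1)
        else if c \<le> \<xi> \<and> \<xi> \<le> 1 then beta_density \<alpha> \<alpha> (\<xi> - c)
        else 0)"

text \<open>
  \<open>Beta(0,0)\<close> has no density. It is read as the weak limit of \<open>Beta(\<alpha>,\<alpha>)\<close> for \<open>\<alpha> \<rightarrow> 0\<close>, which gives mass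
  1/2 to each of \<open>0\<close> and \<open>1\<close>; shifting by \<open>c\<close> modulo 1 moves both atoms to \<open>c\<close>.
\<close>

definition unimix_law :: "real \<Rightarrow> real \<Rightarrow> real \<Rightarrow> real measure" where
  "unimix_law \<pi>i \<pi>j \<alpha> =
     (if \<alpha> = 0 then return borel (unimix_shift \<pi>i \<pi>j)
      else density lborel (\<lambda>\<xi>. ennreal (unimix_density \<pi>i \<pi>j \<alpha> \<xi>)))"

definition unimix_mean :: "real \<Rightarrow> real \<Rightarrow> real \<Rightarrow> real" where
  "unimix_mean \<pi>i \<pi>j \<alpha> = (\<integral>\<xi>. \<xi> \<partial>unimix_law \<pi>i \<pi>j \<alpha>)"

text \<open>
  The sample mixed from \<open>(xi, yi)\<close> and \<open>(xj, yj)\<close> counts as a sample of class \<open>yi\<close> iff the mean of its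
  mixing factor is at least 1/2; this depends on the classes only, not on the features. For
  independent draws from \<open>D\<close>, \<open>mixup_class_law p D \<alpha> A\<close> gives a set \<open>B\<close> of classes the probability that
  \<open>yi \<in> B\<close>, that \<open>(yi, yj) \<in> A\<close> and that the mixed sample counts as one of class \<open>yi\<close>. It is in general
  not normalised: the draws for which the mixed sample counts as one of class \<open>yj\<close> are missing.
\<close>

definition counts_as_first :: "(real \<Rightarrow> real) \<Rightarrow> real \<Rightarrow> real \<Rightarrow> real \<Rightarrow> bool" where
  "counts_as_first p \<alpha> yi yj \<longleftrightarrow> unimix_mean (p yi) (p yj) \<alpha> \<ge> 1 / 2"

definition mixup_class_law ::
    "(real \<Rightarrow> real) \<Rightarrow> ('x \<times> real) measure \<Rightarrow> real \<Rightarrow> (real \<times> real) set \<Rightarrow> real measure" where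
  "mixup_class_law p D \<alpha> A =
     distr
       (density (D \<Otimes>\<^sub>M D)
          (indicator {((xi, yi), (xj, yj)). (yi, yj) \<in> A \<and> counts_as_first p \<alpha> yi yj}))
       lborel (\<lambda>((xi, yi), (xj, yj)). yi)"

definition mixup_density :: "(real \<Rightarrow> real) \<Rightarrow> real \<Rightarrow> real \<Rightarrow> real" where
  "mixup_density p \<alpha> yi =
     p yi * (LINT yj:{..<yi}|lborel. of_bool (unimix_mean (p yi) (p yj) \<alpha> \<ge> 1 / 2) * p yj)"

definition middle_majority :: "real \<Rightarrow> (real \<Rightarrow> real) \<Rightarrow> bool" where
  "middle_majority C q \<longleftrightarrow>
     (\<exists>m. 1 < m \<and> m < C \<and> (q has_real_derivative 0) (at m) \<and>
          strict_mono_on {1..m} q \<and> strict_antimono_on {m..C} q)"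

end

theory Submission
  imports Defs
begin

text \<open>
  Let \<open>F\<close> be the distribution function of \<open>Beta(\<alpha>, \<alpha>)\<close> and \<open>c\<close> the UniMix shift. The mean of the UniMix
  factor is \<open>1/2 + c - F c\<close>, or \<open>c\<close> itself if \<open>\<alpha> = 0\<close>. For \<open>0 < \<alpha> < 1\<close> the beta density decreases on the left half of the unit
  interval and is symmetric, so \<open>F c > c\<close> for \<open>0 < c < 1/2\<close> and \<open>F c \<le> c\<close> for \<open>c \<ge> 1/2\<close>. Hence the mean is at
  least 1/2 iff \<open>c \<ge> 1/2\<close>, that is, iff \<open>yj\<close> is at least as frequent as \<open>yi\<close>; for \<open>\<alpha> = 1\<close> it is always 1/2.
  The density is therefore the prior times its distribution function, a downward parabola in
  \<open>exp (- lam * y)\<close> whose vertex is at \<open>y = 1 + ln 2 / lam\<close>.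
\<close>

section \<open>The symmetric beta density\<close>

lemma has_bochner_integral_beta_density:
  assumes "0 < a"
  shows "has_bochner_integral lborel (beta_density a a) 1"
proof (rule has_bochner_integral_nn_integral)
  have B: "0 < Beta a a"
    using assms by (simp add: Beta_def Gamma_real_pos)
  show "beta_density a a \<in> borel_measurable lborel"
    unfolding beta_density_def by measurable
  show "AE x in lborel. 0 \<le> beta_density a a x"
    using B by (auto simp: beta_density_def)
  have "((\<lambda>t. t powr (a - 1) * (1 - t) powr (a - 1) * (1 / Beta a a)) has_integral Beta a a * (1 / Beta a a)) {0..1}"
    using has_integral_Beta_real[OF assms assms] by (rule has_integral_mult_left)
  then have "(\<integral>\<^sup>+ x. ennreal (indicator {0..1} x * (x powr (a - 1) * (1 - x) powr (a - 1) * (1 / Beta a a))) \<partial>lborel) = ennreal 1"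
    using B by (subst nn_integral_has_integral_lebesgue[where I=1]) auto
  \<comment> \<open>At the endpoints \<open>0\<close> and \<open>1\<close> both functions vanish,
    because \<open>0 powr r = 0\<close> for every \<open>r\<close>.\<close>
  also have "(\<lambda>x. indicator {0..1} x * (x powr (a - 1) * (1 - x) powr (a - 1) * (1 / Beta a a))) = beta_density a a"
    by (auto simp: beta_density_def indicator_def fun_eq_iff)
  finally show "(\<integral>\<^sup>+ x. ennreal (beta_density a a x) \<partial>lborel) = ennreal 1" .
qed simp

lemma beta_density_nonneg: "0 < a \<Longrightarrow> 0 \<le> beta_density a a x"
  by (simp add: beta_density_def Beta_def Gamma_real_pos)

lemma beta_density_reflect: "beta_density a a (1 - x) = beta_density a a x"
  by (simp add: beta_density_def)

lemma borel_measurable_beta_density [measurable]: "beta_density a b \<in> borel_measurable borel"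
  unfolding beta_density_def by measurable

text \<open>The density is a positive multiple of the power \<open>a - 1 \<le> 0\<close> of
  \<open>x * (1 - x)\<close>, which increases up to \<open>1 / 2\<close>.\<close>

lemma beta_density_antimono:
  assumes "0 < a" "a \<le> 1" "0 < x" "x \<le> y" "y \<le> 1 / 2"
  shows "beta_density a a y \<le> beta_density a a x"
proof -
  \<comment> \<open>This product equals \<open>y * (1 - y) - x * (1 - x)\<close>.\<close>
  have "(y - x) * (1 - x - y) \<ge> 0"
    using assms by simp
  then have "x * (1 - x) \<le> y * (1 - y)"
    by (simp add: algebra_simps)
  then have "(y * (1 - y)) powr (a - 1) \<le> (x * (1 - x)) powr (a - 1)"
    using assms by (intro powr_mono2') auto
  moreover have "0 < Beta a a"
    using assms by (simp add: Beta_def Gamma_real_pos)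
  ultimately show ?thesis
    using assms by (simp add: beta_density_def powr_mult divide_right_mono)
qed

lemma beta_density_strict_antimono:
  assumes "0 < a" "a < 1" "0 < x" "x < y" "y \<le> 1 / 2"
  shows "beta_density a a y < beta_density a a x"
proof -
  have "(y - x) * (1 - x - y) > 0"
    using assms by simp
  then have "x * (1 - x) < y * (1 - y)"
    by (simp add: algebra_simps)
  then have "(y * (1 - y)) powr (a - 1) < (x * (1 - x)) powr (a - 1)"
    using assms by (intro powr_less_mono2_neg) auto
  moreover have "0 < Beta a a"
    using assms by (simp add: Beta_def Gamma_real_pos)
  ultimately show ?thesis
    using assms by (simp add: beta_density_def powr_mult divide_strict_right_mono)
qed

section \<open>The distribution function of the symmetric beta law\<close>

definition beta_cdf :: "real \<Rightarrow> real \<Rightarrow> real" where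
  "beta_cdf a x = (LINT t:{..x}|lborel. beta_density a a t)"

context
  fixes a :: real
  assumes a: "0 < a"
begin

lemma integrable_beta_density: "integrable lborel (beta_density a a)"
  and integral_beta_density: "integral\<^sup>L lborel (beta_density a a) = 1"
  using has_bochner_integral_beta_density[OF a] by (auto simp: has_bochner_integral_iff)

lemma set_integrable_beta_density:
  "A \<in> sets borel \<Longrightarrow> set_integrable lborel A (beta_density a a)"
  unfolding set_integrable_def using integrable_beta_density
  by (intro integrable_mult_indicator) auto

text \<open>The density vanishes off the open unit interval, so bounding \<open>g\<close> there
  suffices, even for unbounded factors such as the identity.\<close>

lemma integrable_beta_density_mult:
  assumes [measurable]: "g \<in> borel_measurable borel" and "\<And>x. 0 < x \<Longrightarrow> x < 1 \<Longrightarrow> \<bar>g x\<bar> \<le> 1"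
  shows "integrable lborel (\<lambda>x. g x * beta_density a a x)"
proof (rule Bochner_Integration.integrable_bound[OF integrable_beta_density])
  show "AE x in lborel. norm (g x * beta_density a a x) \<le> norm (beta_density a a x)"
  proof (intro AE_I2)
    fix x
    show "norm (g x * beta_density a a x) \<le> norm (beta_density a a x)"
    proof (cases "0 < x \<and> x < 1")
      case True
      then show ?thesis
        using assms(2)[of x] by (simp add: abs_mult mult_left_le_one_le)
    qed (auto simp: beta_density_def)
  qed
qed measurable

text \<open>The reflection \<open>x \<mapsto> 1 - x\<close> preserves the density, so the mean
  \<open>M\<close> satisfies \<open>M = 1 - M\<close>.\<close>

lemma integral_beta_density_id: "(LINT x|lborel. x * beta_density a a x) = 1 / 2"
proof -
  have i: "integrable lborel (\<lambda>x. x * beta_density a a x)"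
    by (rule integrable_beta_density_mult) auto
  have "(LINT x|lborel. x * beta_density a a x) = (LINT x|lborel. (1 - x) * beta_density a a x)"
    by (subst lborel_integral_real_affine[where c="-1" and t=1]) (auto simp: beta_density_reflect)
  also have "\<dots> = (LINT x|lborel. beta_density a a x) - (LINT x|lborel. x * beta_density a a x)"
    using i integrable_beta_density by (simp add: left_diff_distrib)
  finally show ?thesis
    by (simp add: integral_beta_density)
qed

lemma beta_cdf_alt: "(LINT t|lborel. indicator {1 - x..} t * beta_density a a t) = beta_cdf a x"
  unfolding beta_cdf_def set_lebesgue_integral_def
  by (subst lborel_integral_real_affine[where c="-1" and t=1])
     (auto simp: beta_density_reflect intro!: Bochner_Integration.integral_cong split: split_indicator)

text \<open>The tails below and above \<open>1 - x\<close> overlap in one point, a null set, so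
  their masses add up to 1.\<close>

lemma beta_cdf_compl: "(LINT t|lborel. indicator {..1 - x} t * beta_density a a t) = 1 - beta_cdf a x"
proof -
  have i: "integrable lborel (\<lambda>t. indicator A t * beta_density a a t)" if "A \<in> sets borel" for A
    using set_integrable_beta_density[OF that] by (simp add: set_integrable_def)
  have "(LINT t|lborel. indicator {..1 - x} t * beta_density a a t) + beta_cdf a x =
      (LINT t|lborel. indicator {..1 - x} t * beta_density a a t + indicator {1 - x..} t * beta_density a a t)"
    using i by (subst Bochner_Integration.integral_add) (auto simp: beta_cdf_alt)
  also have "\<dots> = (LINT t|lborel. beta_density a a t)"
  proof (rule integral_cong_AE)
    show "AE t in lborel. indicator {..1 - x} t * beta_density a a t + indicator {1 - x..} t * beta_density a a t
        = beta_density a a t"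
      using AE_lborel_singleton[of "1 - x"] by eventually_elim (auto split: split_indicator)
  qed measurable
  finally show ?thesis
    by (simp add: integral_beta_density)
qed

lemma beta_cdf_reflect: "beta_cdf a (1 - x) = 1 - beta_cdf a x"
  using beta_cdf_compl[of x] by (simp add: beta_cdf_def set_lebesgue_integral_def)

lemma beta_cdf_diff:
  assumes "x \<le> y"
  shows "beta_cdf a y - beta_cdf a x = (LINT t:{x<..y}|lborel. beta_density a a t)"
proof -
  have "{..y} = {..x} \<union> {x<..y}"
    using assms by auto
  moreover have "(LINT t:{..x} \<union> {x<..y}|lborel. beta_density a a t) =
      (LINT t:{..x}|lborel. beta_density a a t) + (LINT t:{x<..y}|lborel. beta_density a a t)"
    by (intro set_integral_Un set_integrable_beta_density) auto
  ultimately show ?thesis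
    by (simp add: beta_cdf_def)
qed

lemma beta_cdf_0: "beta_cdf a 0 = 0"
proof -
  have "(\<lambda>t. indicator {..0} t *\<^sub>R beta_density a a t) = (\<lambda>_. 0)"
    by (auto simp: beta_density_def fun_eq_iff split: split_indicator)
  then show ?thesis
    by (simp add: beta_cdf_def set_lebesgue_integral_def)
qed

text \<open>A decreasing density is bounded below by its value at the right end. The half-open
  interval excludes \<open>x\<close>, so \<open>x = 0\<close> is allowed although
  \<open>beta_density\<close> is set to 0 there.\<close>

lemma beta_cdf_diff_ge:
  assumes "a \<le> 1" "0 \<le> x" "x \<le> y" "y \<le> 1 / 2"
  shows "(y - x) * beta_density a a y \<le> beta_cdf a y - beta_cdf a x"
proof -
  have "(y - x) * beta_density a a y = (LINT t:{x<..y}|lborel. beta_density a a y)"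
    using assms by (simp add: set_integral_const)
  also have "\<dots> \<le> (LINT t:{x<..y}|lborel. beta_density a a t)"
    using assms a
    by (intro set_integral_mono set_integrable_beta_density) (auto simp: set_integrable_def intro: beta_density_antimono)
  finally show ?thesis
    using assms by (simp add: beta_cdf_diff)
qed

text \<open>Here the value at the left end is the bound, hence \<open>0 < x\<close>: at 0 it would
  be the default value 0.\<close>

lemma beta_cdf_diff_le:
  assumes "a \<le> 1" "0 < x" "x \<le> y" "y \<le> 1 / 2"
  shows "beta_cdf a y - beta_cdf a x \<le> (y - x) * beta_density a a x"
proof -
  have "(LINT t:{x<..y}|lborel. beta_density a a t) \<le> (LINT t:{x<..y}|lborel. beta_density a a x)"
    using assms a
    by (intro set_integral_mono set_integrable_beta_density) (auto simp: set_integrable_def intro: beta_density_antimono)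
  also have "\<dots> = (y - x) * beta_density a a x"
    using assms by (simp add: set_integral_const)
  finally show ?thesis
    using assms by (simp add: beta_cdf_diff)
qed

lemma beta_cdf_half: "beta_cdf a (1 / 2) = 1 / 2"
  using beta_cdf_reflect[of "1 / 2"] by simp

text \<open>The density decreases on the left half, so the average over \<open>{0..c}\<close> is at least that over
  \<open>{c..1/2}\<close>.\<close>

lemma beta_cdf_ge:
  assumes "a \<le> 1" "0 \<le> c" "c \<le> 1 / 2"
  shows "c \<le> beta_cdf a c"
proof (cases "c = 0")
  case False
  have "c * beta_density a a c \<le> beta_cdf a c"
    using beta_cdf_diff_ge[of 0 c] assms by (simp add: beta_cdf_0)
  moreover have "1 / 2 - beta_cdf a c \<le> (1 / 2 - c) * beta_density a a c"
    using beta_cdf_diff_le[of c "1 / 2"] assms False by (simp add: beta_cdf_half)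
  \<comment> \<open>Both sides are compared with
    \<open>c * (1 / 2 - c) * beta_density a a c\<close>; the products
    \<open>c * beta_cdf a c\<close> then cancel.\<close>
  ultimately have "c * (1 / 2 - beta_cdf a c) \<le> (1 / 2 - c) * beta_cdf a c"
    using assms by (smt (verit) mult.left_commute mult_left_mono)
  then show ?thesis
    by (simp add: algebra_simps)
qed (simp add: beta_cdf_0)

text \<open>Strictness comes from splitting at \<open>c / 2\<close>: the density on the first piece
  is at least its value at \<open>c / 2\<close>, which exceeds the one at \<open>c\<close>.\<close>

lemma beta_cdf_gt:
  assumes "a < 1" "0 < c" "c < 1 / 2"
  shows "c < beta_cdf a c"
proof -
  have "c / 2 * beta_density a a (c / 2) \<le> beta_cdf a (c / 2)"
    using beta_cdf_diff_ge[of 0 "c / 2"] assms by (simp add: beta_cdf_0)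
  moreover have "c / 2 * beta_density a a c \<le> beta_cdf a c - beta_cdf a (c / 2)"
    using beta_cdf_diff_ge[of "c / 2" c] assms by simp
  moreover have "c / 2 * beta_density a a c < c / 2 * beta_density a a (c / 2)"
    using beta_density_strict_antimono[of a "c / 2" c] a assms by simp
  ultimately have "c * beta_density a a c < beta_cdf a c"
    by linarith
  then have "(1 / 2 - c) * (c * beta_density a a c) < (1 / 2 - c) * beta_cdf a c"
    using assms by simp
  moreover have "1 / 2 - beta_cdf a c \<le> (1 / 2 - c) * beta_density a a c"
    using beta_cdf_diff_le[of c "1 / 2"] assms by (simp add: beta_cdf_half)
  then have "c * (1 / 2 - beta_cdf a c) \<le> c * ((1 / 2 - c) * beta_density a a c)"
    using assms by simp
  ultimately show ?thesis
    by (simp add: algebra_simps)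
qed

end

section \<open>The mean of the UniMix factor\<close>

lemma borel_measurable_unimix_density [measurable]: "unimix_density \<pi>i \<pi>j \<alpha> \<in> borel_measurable borel"
  unfolding unimix_density_def Let_def by measurable

lemma unimix_density_nonneg: "0 < \<alpha> \<Longrightarrow> 0 \<le> unimix_density \<pi>i \<pi>j \<alpha> x"
  by (simp add: unimix_density_def Let_def beta_density_nonneg)

lemma unimix_mean_pos:
  assumes "0 < \<alpha>"
  shows "unimix_mean \<pi>i \<pi>j \<alpha> = (LINT \<xi>|lborel. unimix_density \<pi>i \<pi>j \<alpha> \<xi> * \<xi>)"
  using assms unfolding unimix_mean_def unimix_law_def
  by (simp add: integral_real_density unimix_density_nonneg)

lemma unimix_mean_zero: "unimix_mean \<pi>i \<pi>j 0 = unimix_shift \<pi>i \<pi>j"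
  by (simp add: unimix_mean_def unimix_law_def integral_return)

text \<open>For \<open>X\<close> distributed as \<open>Beta(\<alpha>, \<alpha>)\<close> the UniMix factor is \<open>X + c\<close> modulo 1, so its mean is
  \<open>1/2 + c\<close> minus the probability of \<open>X \<ge> 1 - c\<close>, which by symmetry is that of \<open>X \<le> c\<close>.\<close>

lemma unimix_mean_eq:
  assumes "0 < \<alpha>" and c: "c = unimix_shift \<pi>i \<pi>j" "0 \<le> c" "c \<le> 1"
  shows "unimix_mean \<pi>i \<pi>j \<alpha> = 1 / 2 + c - beta_cdf \<alpha> c"
proof -
  let ?f = "beta_density \<alpha> \<alpha>"
  have i: "integrable lborel (\<lambda>x. indicator {1 - c..} x * (x + c - 1) * ?f x)"
      "integrable lborel (\<lambda>x. indicator {..1 - c} x * (x + c) * ?f x)"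
    using c assms(1) by (auto intro!: integrable_beta_density_mult split: split_indicator)
  \<comment> \<open>Each branch of the density is translated back to the beta variable. In the
    substitutions \<open>c=1\<close> is the scaling factor, not the shift.\<close>
  have s: "(LINT x|lborel. indicator {0..} x * x * ?f (x - c + 1)) =
        (LINT x|lborel. indicator {1 - c..} x * (x + c - 1) * ?f x)"
      "(LINT x|lborel. indicator {..1} x * x * ?f (x - c)) =
        (LINT x|lborel. indicator {..1 - c} x * (x + c) * ?f x)"
    by (subst lborel_integral_real_affine[where c=1 and t="c - 1"];
        auto simp: add_ac intro!: Bochner_Integration.integral_cong split: split_indicator)
      (subst lborel_integral_real_affine[where c=1 and t=c];
        auto simp: add_ac intro!: Bochner_Integration.integral_cong split: split_indicator)
  have i': "integrable lborel (\<lambda>x. indicator {0..} x * x * ?f (x - c + 1))"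
      "integrable lborel (\<lambda>x. indicator {..1} x * x * ?f (x - c))"
  proof -
    have "(\<lambda>x. indicator {0..} x * x * ?f (x - c + 1)) =
        (\<lambda>x. (\<lambda>y. indicator {1 - c..} y * (y + c - 1) * ?f y) (1 - c + 1 * x))"
      by (auto simp: fun_eq_iff algebra_simps split: split_indicator)
    then show "integrable lborel (\<lambda>x. indicator {0..} x * x * ?f (x - c + 1))"
      using lborel_integrable_real_affine[OF i(1), of 1 "1 - c"] by simp
    have "(\<lambda>x. indicator {..1} x * x * ?f (x - c)) =
        (\<lambda>x. (\<lambda>y. indicator {..1 - c} y * (y + c) * ?f y) (- c + 1 * x))"
      by (auto simp: fun_eq_iff algebra_simps split: split_indicator)
    then show "integrable lborel (\<lambda>x. indicator {..1} x * x * ?f (x - c))"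
      using lborel_integrable_real_affine[OF i(2), of 1 "- c"] by simp
  qed
  \<comment> \<open>Only one bound per branch remains: the support of the beta density enforces
    \<open>x < c\<close> in the first and \<open>c < x\<close> in the second.\<close>
  have "unimix_mean \<pi>i \<pi>j \<alpha> = (LINT x|lborel. indicator {0..} x * x * ?f (x - c + 1) + indicator {..1} x * x * ?f (x - c))"
    unfolding unimix_mean_pos[OF assms(1)] unimix_density_def Let_def c(1)[symmetric]
    using c by (intro Bochner_Integration.integral_cong) (auto simp: beta_density_def split: split_indicator)
  also have "\<dots> = (LINT x|lborel. indicator {1 - c..} x * (x + c - 1) * ?f x) +
      (LINT x|lborel. indicator {..1 - c} x * (x + c) * ?f x)"
    using i' by (subst Bochner_Integration.integral_add) (simp_all add: s)
  also have "\<dots> = (LINT x|lborel. indicator {1 - c..} x * (x + c - 1) * ?f x + indicator {..1 - c} x * (x + c) * ?f x)"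
    using i by simp
  also have "\<dots> = (LINT x|lborel. x * ?f x + c * ?f x - indicator {1 - c..} x * ?f x)"
  proof (rule integral_cong_AE)
    show "AE x in lborel. indicator {1 - c..} x * (x + c - 1) * ?f x + indicator {..1 - c} x * (x + c) * ?f x
        = x * ?f x + c * ?f x - indicator {1 - c..} x * ?f x"
      using AE_lborel_singleton[of "1 - c"]
      by eventually_elim (auto simp: algebra_simps split: split_indicator)
  qed measurable
  also have "\<dots> = 1 / 2 + c - beta_cdf \<alpha> c"
  proof -
    have "integrable lborel (\<lambda>x. x * ?f x)" "integrable lborel (\<lambda>x. indicator {1 - c..} x * ?f x)"
      using assms(1) by (auto intro!: integrable_beta_density_mult split: split_indicator)
    then show ?thesis
      using integrable_beta_density[OF assms(1)]
      by (simp add: integral_beta_density_id integral_beta_density beta_cdf_alt assms(1))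
  qed
  finally show ?thesis .
qed

lemma unimix_shift_bounds:
  assumes "0 < \<pi>i" "0 < \<pi>j"
  shows "0 < unimix_shift \<pi>i \<pi>j" "unimix_shift \<pi>i \<pi>j < 1"
    "1 / 2 \<le> unimix_shift \<pi>i \<pi>j \<longleftrightarrow> \<pi>i \<le> \<pi>j"
  using assms by (auto simp: unimix_shift_def field_simps)

text \<open>For positive \<open>\<alpha>\<close> the claim is
  \<open>beta_cdf \<alpha> c \<le> c\<close>, the reflection of \<open>beta_cdf_ge\<close> at
  \<open>1 - c \<le> 1 / 2\<close>.\<close>

lemma unimix_mean_ge_half:
  assumes "0 \<le> \<alpha>" "\<alpha> \<le> 1" "0 < \<pi>i" "\<pi>i \<le> \<pi>j"
  shows "1 / 2 \<le> unimix_mean \<pi>i \<pi>j \<alpha>"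
proof (cases "\<alpha> = 0")
  case True
  then show ?thesis
    using assms unimix_shift_bounds[of \<pi>i \<pi>j] by (simp add: unimix_mean_zero)
next
  case False
  define c where "c = unimix_shift \<pi>i \<pi>j"
  have c: "0 < c" "c < 1" "1 / 2 \<le> c"
    using assms unimix_shift_bounds[of \<pi>i \<pi>j] by (auto simp: c_def)
  have "1 - c \<le> beta_cdf \<alpha> (1 - c)"
    using False assms c by (intro beta_cdf_ge) auto
  then have "beta_cdf \<alpha> c \<le> c"
    using False assms by (simp add: beta_cdf_reflect)
  then show ?thesis
    using unimix_mean_eq[OF _ c_def] False assms c by simp
qed

text \<open>This is where \<open>\<alpha> < 1\<close> matters: for the uniform law the mean is 1/2
  whatever the priors are.\<close>

lemma unimix_mean_less_half:
  assumes "0 \<le> \<alpha>" "\<alpha> < 1" "0 < \<pi>j" "\<pi>j < \<pi>i"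
  shows "unimix_mean \<pi>i \<pi>j \<alpha> < 1 / 2"
proof (cases "\<alpha> = 0")
  case True
  then show ?thesis
    using assms unimix_shift_bounds[of \<pi>i \<pi>j] by (simp add: unimix_mean_zero)
next
  case False
  define c where "c = unimix_shift \<pi>i \<pi>j"
  have c: "0 < c" "c < 1" "c < 1 / 2"
    using assms unimix_shift_bounds[of \<pi>i \<pi>j] by (auto simp: c_def)
  have "c < beta_cdf \<alpha> c"
    using False assms c by (intro beta_cdf_gt) auto
  then show ?thesis
    using unimix_mean_eq[OF _ c_def] False assms c by simp
qed

lemma borel_measurable_unimix_mean [measurable (raw)]:
  assumes [measurable]: "f \<in> borel_measurable M" "g \<in> borel_measurable M" and "0 \<le> \<alpha>"
  shows "(\<lambda>x. unimix_mean (f x) (g x) \<alpha>) \<in> borel_measurable M"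
proof (cases "\<alpha> = 0")
  case True
  then show ?thesis
    by (simp add: unimix_mean_zero unimix_shift_def)
next
  case False
  then show ?thesis
    using assms(3) by (simp add: unimix_mean_pos unimix_density_def Let_def unimix_shift_def)
qed

section \<open>From pairs of samples to the density of the mixed class\<close>

lemma distributed_pair_snd:
  assumes "prob_space D" and "distributed D lborel snd (\<lambda>y. ennreal (p y))"
  shows "distr (D \<Otimes>\<^sub>M D) (lborel \<Otimes>\<^sub>M lborel) (\<lambda>(u, v). (snd u, snd v)) =
    density lborel (\<lambda>y. ennreal (p y)) \<Otimes>\<^sub>M density lborel (\<lambda>y. ennreal (p y))"
proof -
  have m: "snd \<in> D \<rightarrow>\<^sub>M lborel"
    using assms(2) by (rule distributed_measurable)
  then interpret P: prob_space "distr D lborel snd"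
    by (rule prob_space.prob_space_distr[OF assms(1)])
  show ?thesis
    using pair_measure_distr[OF m m P.sigma_finite_measure_axioms]
    by (simp add: distributed_distr_eq_density[OF assms(2)])
qed

text \<open>Only labels enter, so the law is computed by Tonelli on pairs of classes.
  \<open>counts\<close> compares \<open>A\<close> with \<open>z < y\<close> only off the diagonal, a
  null set, and for positive priors, so that one proof serves both choices of \<open>A\<close> in
  the theorem.\<close>

lemma mixup_class_law_eq:
  fixes p :: "real \<Rightarrow> real"
  assumes D: "prob_space D" "distributed D lborel snd (\<lambda>y. ennreal (p y))"
    and p [measurable]: "p \<in> borel_measurable borel" and p_nonneg: "\<And>y. 0 \<le> p y"
    and \<alpha>: "0 \<le> \<alpha>"
    and A [measurable]: "A \<in> sets (lborel \<Otimes>\<^sub>M lborel)"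
    and counts: "\<And>y z. 0 < p y \<Longrightarrow> 0 < p z \<Longrightarrow> y \<noteq> z \<Longrightarrow>
      (y, z) \<in> A \<and> counts_as_first p \<alpha> y z \<longleftrightarrow> z < y \<and> counts_as_first p \<alpha> y z"
  shows "mixup_class_law p D \<alpha> A = density lborel (\<lambda>y. ennreal (mixup_density p \<alpha> y))"
proof -
  define P where "P = density lborel (\<lambda>y. ennreal (p y))"
  define S where "S = {(y, z). (y, z) \<in> A \<and> counts_as_first p \<alpha> y z}"
  define g where "g y z = (if z < y \<and> 1 / 2 \<le> unimix_mean (p y) (p z) \<alpha> then p z else 0)" for y z
  let ?L = "lborel \<Otimes>\<^sub>M lborel :: (real \<times> real) measure"
  let ?h = "\<lambda>(u, v). (snd u, snd v) :: real \<times> real"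
  have [measurable]: "snd \<in> D \<rightarrow>\<^sub>M lborel"
    using D(2) by (rule distributed_measurable)
  have [measurable]: "(\<lambda>w. unimix_mean (p (fst w)) (p (snd w)) \<alpha>) \<in> borel_measurable ?L"
    using \<alpha> by measurable
  have "S = {w \<in> space ?L. w \<in> A \<and> 1 / 2 \<le> unimix_mean (p (fst w)) (p (snd w)) \<alpha>}"
    by (auto simp: S_def counts_as_first_def space_pair_measure)
  also have "\<dots> \<in> sets ?L"
    by measurable
  finally have S [measurable]: "S \<in> sets ?L" .
  have g [measurable]: "case_prod g \<in> borel_measurable ?L"
  proof -
    have "case_prod g = (\<lambda>w. if snd w < fst w \<and> 1 / 2 \<le> unimix_mean (p (fst w)) (p (snd w)) \<alpha> then p (snd w) else 0)"
      by (auto simp: g_def fun_eq_iff)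
    also have "\<dots> \<in> borel_measurable ?L"
      by measurable
    finally show ?thesis .
  qed
  have density: "mixup_density p \<alpha> y = p y * (LINT z|lborel. g y z)" for y
    unfolding mixup_density_def set_lebesgue_integral_def
    by (intro arg_cong2[where f="(*)"] Bochner_Integration.integral_cong)
      (auto simp: g_def split: split_indicator)
  have [measurable]: "mixup_density p \<alpha> \<in> borel_measurable borel"
    unfolding density[abs_def] by measurable
  have "prob_space P"
    unfolding P_def distributed_distr_eq_density[OF D(2), symmetric]
    by (rule prob_space.prob_space_distr[OF D(1)]) measurable
  then interpret P: prob_space P .
  have int_p: "integrable lborel p"
  proof (rule integrableI_nn_integral_finite)
    show "(\<integral>\<^sup>+ x. ennreal (p x) \<partial>lborel) = ennreal 1"
      using P.emeasure_space_1 by (simp add: P_def emeasure_density)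
  qed (use p_nonneg in auto)
  have int_g: "integrable lborel (g y)" for y
    by (rule Bochner_Integration.integrable_bound[OF int_p]) (auto simp: g_def)
  \<comment> \<open>If \<open>p y = 0\<close>, both sides vanish, so \<open>counts\<close> has to be
    applied only for positive \<open>p y\<close>.\<close>
  have inner: "ennreal (p y) * (\<integral>\<^sup>+ z. indicator S (y, z) \<partial>P) = ennreal (mixup_density p \<alpha> y)" for y
  proof (cases "p y = 0")
    case False
    then have py: "0 < p y"
      using p_nonneg[of y] by simp
    have "(\<integral>\<^sup>+ z. indicator S (y, z) \<partial>P) = (\<integral>\<^sup>+ z. ennreal (p z) * indicator S (y, z) \<partial>lborel)"
      unfolding P_def by (subst nn_integral_density) auto
    also have "\<dots> = (\<integral>\<^sup>+ z. ennreal (g y z) \<partial>lborel)"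
    proof (rule nn_integral_cong_AE)
      show "AE z in lborel. ennreal (p z) * indicator S (y, z) = ennreal (g y z)"
        using AE_lborel_singleton[of y]
      proof eventually_elim
        case (elim z)
        then show ?case
          using counts[OF py, of z] p_nonneg[of z]
          by (cases "p z = 0") (auto simp: g_def S_def counts_as_first_def split: split_indicator)
      qed
    qed
    also have "\<dots> = ennreal (LINT z|lborel. g y z)"
      using p_nonneg by (intro nn_integral_eq_integral int_g AE_I2) (simp add: g_def)
    finally show ?thesis
      by (simp add: density ennreal_mult' p_nonneg)
  qed (simp add: density)
  have "mixup_class_law p D \<alpha> A =
      distr (density (D \<Otimes>\<^sub>M D) (\<lambda>w. indicator S (?h w))) lborel (\<lambda>w. fst (?h w))"
    unfolding mixup_class_law_def
    by (intro arg_cong2[where f="\<lambda>f g. distr (density (D \<Otimes>\<^sub>M D) f) lborel g"])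
      (auto simp: S_def fun_eq_iff split: split_indicator)
  \<comment> \<open>The projection factors through the pair of labels, and so does the indicator
    weight; the weight can therefore be moved to the product of the label laws.\<close>
  also have "\<dots> = distr (distr (density (D \<Otimes>\<^sub>M D) (\<lambda>w. indicator S (?h w))) ?L ?h) lborel fst"
    by (subst distr_distr) (auto simp: comp_def)
  also have "\<dots> = distr (density (P \<Otimes>\<^sub>M P) (indicator S)) lborel fst"
    by (subst density_distr[symmetric]) (auto simp: distributed_pair_snd[OF D] P_def)
  also have "\<dots> = density lborel (\<lambda>y. ennreal (mixup_density p \<alpha> y))"
  proof (rule measure_eqI)
    fix B assume "B \<in> sets (distr (density (P \<Otimes>\<^sub>M P) (indicator S)) lborel fst)"
    then have B [measurable]: "B \<in> sets borel"
      by simp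
    have sets_P [measurable_cong]: "sets P = sets borel"
      by (simp add: P_def)
    have [measurable]: "S \<in> sets (P \<Otimes>\<^sub>M P)"
      using S by (simp add: sets_P cong: sets_pair_measure_cong)
    have nn_integral_P: "(\<integral>\<^sup>+ y. h y \<partial>P) = (\<integral>\<^sup>+ y. ennreal (p y) * h y \<partial>lborel)"
      if "h \<in> borel_measurable P" for h
      using that unfolding P_def by (subst nn_integral_density) auto
    have "emeasure (distr (density (P \<Otimes>\<^sub>M P) (indicator S)) lborel fst) B =
        (\<integral>\<^sup>+ w. indicator S w * indicator B (fst w) \<partial>(P \<Otimes>\<^sub>M P))"
      by (subst emeasure_distr; (subst emeasure_density)?)
        (auto intro!: nn_integral_cong split: split_indicator)
    also have "\<dots> = (\<integral>\<^sup>+ y. \<integral>\<^sup>+ z. indicator S (y, z) * indicator B y \<partial>P \<partial>P)"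
      by (subst P.nn_integral_fst[symmetric]) auto
    also have "\<dots> = (\<integral>\<^sup>+ y. (\<integral>\<^sup>+ z. indicator S (y, z) \<partial>P) * indicator B y \<partial>P)"
      by (intro nn_integral_cong nn_integral_multc) auto
    also have "\<dots> = (\<integral>\<^sup>+ y. ennreal (p y) * ((\<integral>\<^sup>+ z. indicator S (y, z) \<partial>P) * indicator B y) \<partial>lborel)"
      by (rule nn_integral_P) measurable
    also have "\<dots> = (\<integral>\<^sup>+ y. ennreal (mixup_density p \<alpha> y) * indicator B y \<partial>lborel)"
      by (simp add: inner mult.assoc[symmetric])
    also have "\<dots> = emeasure (density lborel (\<lambda>y. ennreal (mixup_density p \<alpha> y))) B"
      by (simp add: emeasure_density)
    finally show "emeasure (distr (density (P \<Otimes>\<^sub>M P) (indicator S)) lborel fst) B =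
        emeasure (density lborel (\<lambda>y. ennreal (mixup_density p \<alpha> y))) B" .
  qed simp
  finally show ?thesis .
qed

section \<open>The long-tailed prior and the closed form\<close>

context
  fixes lam C :: real
  assumes lam: "0 < lam" and C: "1 < C"
begin

lemma longtail_denominator_pos: "exp (- (lam * C)) < exp (- lam)"
  using lam C by simp

lemma longtail_prior_pos_iff: "0 < longtail_prior lam C y \<longleftrightarrow> 1 \<le> y \<and> y \<le> C"
  using lam C by (simp add: longtail_prior_def)

lemma longtail_prior_nonneg: "0 \<le> longtail_prior lam C y"
  using longtail_prior_pos_iff[of y] by (auto simp: longtail_prior_def)

lemma longtail_prior_strict_antimono: "strict_antimono_on {1..C} (longtail_prior lam C)"
  using lam C by (intro monotone_onI) (simp add: longtail_prior_def divide_strict_right_mono)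

lemma borel_measurable_longtail_prior [measurable]: "longtail_prior lam C \<in> borel_measurable borel"
  unfolding longtail_prior_def by measurable

lemma integral_longtail_prior:
  assumes "1 \<le> y" "y \<le> C"
  shows "(LINT z:{1..y}|lborel. longtail_prior lam C z) =
    (exp (- lam) - exp (- lam * y)) / (exp (- lam) - exp (- lam * C))"
proof -
  let ?K = "exp (- lam) - exp (- lam * C)"
  \<comment> \<open>The antiderivative is \<open>- exp (- lam * z) / ?K\<close>.\<close>
  have "has_bochner_integral lborel (\<lambda>z. (lam / ?K * exp (- lam * z)) * indicator {1..y} z)
      (- exp (- lam * y) / ?K - (- exp (- lam * 1) / ?K))"
    using assms by (intro has_bochner_integral_FTC_Icc_real) (use longtail_denominator_pos in \<open>auto intro!: derivative_eq_intros continuous_intros\<close>)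
  then have "(LINT z|lborel. (lam / ?K * exp (- lam * z)) * indicator {1..y} z) = (exp (- lam) - exp (- lam * y)) / ?K"
    by (simp add: has_bochner_integral_iff diff_divide_distrib)
  also have "(LINT z|lborel. (lam / ?K * exp (- lam * z)) * indicator {1..y} z) =
      (LINT z:{1..y}|lborel. longtail_prior lam C z)"
    unfolding set_lebesgue_integral_def using assms
    by (intro Bochner_Integration.integral_cong) (auto simp: longtail_prior_def split: split_indicator)
  finally show ?thesis .
qed

text \<open>Every class \<open>z < y\<close> in the range is more frequent than \<open>y\<close>, so
  the indicator is 1 and the inner integral is the distribution function of the prior.\<close>

lemma mixup_density_longtail_prior:
  assumes "0 \<le> \<alpha>" "\<alpha> \<le> 1" and y: "1 \<le> y" "y \<le> C"
  shows "mixup_density (longtail_prior lam C) \<alpha> y =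
    lam / (exp (- lam) - exp (- lam * C))\<^sup>2 * (exp (- lam * (y + 1)) - exp (- 2 * lam * y))"
proof -
  let ?p = "longtail_prior lam C" and ?K = "exp (- lam) - exp (- lam * C)"
  have mean: "1 / 2 \<le> unimix_mean (?p y) (?p z) \<alpha>" if "1 \<le> z" "z < y" for z
    using monotone_onD[OF longtail_prior_strict_antimono, of z y] that y assms
    by (intro unimix_mean_ge_half) (auto simp: longtail_prior_pos_iff)
  have "(LINT z:{..<y}|lborel. of_bool (1 / 2 \<le> unimix_mean (?p y) (?p z) \<alpha>) * ?p z) =
      (LINT z:{1..<y}|lborel. ?p z)"
    unfolding set_lebesgue_integral_def
  proof (intro Bochner_Integration.integral_cong refl)
    fix z
    show "indicator {..<y} z *\<^sub>R (of_bool (1 / 2 \<le> unimix_mean (?p y) (?p z) \<alpha>) * ?p z) =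
        indicator {1..<y} z *\<^sub>R ?p z"
      using mean[of z] by (cases "1 \<le> z") (auto simp: longtail_prior_def split: split_indicator)
  qed
  also have "\<dots> = (LINT z:{1..y}|lborel. ?p z)"
    unfolding set_lebesgue_integral_def
  proof (rule integral_cong_AE)
    show "AE z in lborel. indicator {1..<y} z *\<^sub>R ?p z = indicator {1..y} z *\<^sub>R ?p z"
      using AE_lborel_singleton[of y] by eventually_elim (auto split: split_indicator)
  qed measurable
  finally have "mixup_density ?p \<alpha> y =
      (lam / ?K * exp (- lam * y)) * ((exp (- lam) - exp (- lam * y)) / ?K)"
    unfolding mixup_density_def integral_longtail_prior[OF y] using y by (simp add: longtail_prior_def)
  also have "\<dots> = lam / ?K\<^sup>2 * (exp (- lam * y) * exp (- lam) - exp (- lam * y) * exp (- lam * y))"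
  proof -
    have "(a / k * b) * ((c - d) / k) = a / k\<^sup>2 * (b * c - b * d)" for a b c d k :: real
      by (simp add: power2_eq_square right_diff_distrib diff_divide_distrib)
    then show ?thesis .
  qed
  also have "\<dots> = lam / ?K\<^sup>2 * (exp (- lam * (y + 1)) - exp (- 2 * lam * y))"
    by (simp add: exp_add[symmetric] algebra_simps)
  finally show ?thesis .
qed

end

section \<open>The shape of the exponential profile\<close>

text \<open>The derivative is
  \<open>K * lam * (2 * exp (- 2 * lam * m) - exp (- lam * (m + 1)))\<close>. The set
  \<open>S\<close> leaves room for a one-sided derivative at the end of the class range.\<close>

lemma has_real_derivative_exp_profile:
  fixes lam K :: real
  assumes "exp (- lam * m) = exp (- lam) / 2"
  shows "((\<lambda>y. K * (exp (- lam * (y + 1)) - exp (- 2 * lam * y))) has_real_derivative 0) (at m within S)"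
proof -
  have "exp (- lam * (m + 1)) = exp (- lam * m) * exp (- lam)"
    by (simp add: exp_add[symmetric] algebra_simps)
  moreover have "exp (- 2 * lam * m) = exp (- lam * m) * exp (- lam * m)"
    by (simp add: exp_add[symmetric])
  ultimately have "2 * exp (- 2 * lam * m) = exp (- lam * (m + 1))"
    unfolding assms by simp
  then show ?thesis
    by (auto intro!: derivative_eq_intros simp: algebra_simps)
qed

text \<open>In terms of \<open>u = exp (- lam * y)\<close> the profile is the parabola \<open>K * (exp (- lam) * u - u\<^sup>2)\<close> with
  vertex \<open>u = exp (- lam) / 2\<close>.\<close>

lemma exp_profile_diff:
  fixes lam K :: real
  shows "K * (exp (- lam * (x + 1)) - exp (- 2 * lam * x)) - K * (exp (- lam * (y + 1)) - exp (- 2 * lam * y)) =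
    K * (exp (- lam * x) - exp (- lam * y)) * (exp (- lam) - exp (- lam * x) - exp (- lam * y))"
proof -
  have "exp (- lam * (y + 1)) = exp (- lam * y) * exp (- lam)"
      "exp (- 2 * lam * y) = exp (- lam * y) * exp (- lam * y)" for y
    by (simp_all add: exp_add[symmetric] algebra_simps)
  then show ?thesis
    by (simp only:) (simp add: algebra_simps)
qed

text \<open>Up to \<open>m\<close> both exponentials are at least \<open>exp (- lam) / 2\<close>,
  one of them strictly greater, so the last factor in \<open>exp_profile_diff\<close> is
  negative.\<close>

lemma exp_profile_strict_mono:
  fixes lam K :: real
  assumes "0 < lam" "0 < K" and m: "exp (- lam * m) = exp (- lam) / 2"
  shows "strict_mono_on {..m} (\<lambda>y. K * (exp (- lam * (y + 1)) - exp (- 2 * lam * y)))"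
proof (rule monotone_onI)
  fix x y assume xy: "x \<in> {..m}" "y \<in> {..m}" "x < y"
  then have "exp (- lam * y) < exp (- lam * x)" "exp (- lam * m) \<le> exp (- lam * y)"
    using assms by simp_all
  then have "K * (exp (- lam * x) - exp (- lam * y)) * (exp (- lam) - exp (- lam * x) - exp (- lam * y)) < 0"
    using assms(2) unfolding m by (intro mult_pos_neg mult_pos_pos) linarith+
  then show "K * (exp (- lam * (x + 1)) - exp (- 2 * lam * x)) < K * (exp (- lam * (y + 1)) - exp (- 2 * lam * y))"
    unfolding exp_profile_diff[symmetric] by simp
qed

text \<open>From \<open>m\<close> on both exponentials are at most \<open>exp (- lam) / 2\<close>,
  so the last factor in \<open>exp_profile_diff\<close> changes sign.\<close>

lemma exp_profile_strict_antimono: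
  fixes lam K :: real
  assumes "0 < lam" "0 < K" and m: "exp (- lam * m) = exp (- lam) / 2"
  shows "strict_antimono_on {m..} (\<lambda>y. K * (exp (- lam * (y + 1)) - exp (- 2 * lam * y)))"
proof (rule monotone_onI)
  fix x y assume xy: "x \<in> {m..}" "y \<in> {m..}" "x < y"
  then have "exp (- lam * y) < exp (- lam * x)" "exp (- lam * x) \<le> exp (- lam * m)"
    using assms by simp_all
  then have "0 < K * (exp (- lam * x) - exp (- lam * y)) * (exp (- lam) - exp (- lam * x) - exp (- lam * y))"
    using assms(2) unfolding m by (intro mult_pos_pos) linarith+
  then show "K * (exp (- lam * (y + 1)) - exp (- 2 * lam * y)) < K * (exp (- lam * (x + 1)) - exp (- 2 * lam * x))"
    unfolding exp_profile_diff[symmetric] by simp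
qed

text \<open>For \<open>\<alpha> < 1\<close> the mean condition by itself forces
  \<open>yj < yi\<close> almost surely; for \<open>\<alpha> = 1\<close> the mean is always 1/2, so
  the order is imposed through \<open>A\<close>. The critical point lies in the class range iff
  \<open>2 \<le> \<rho>\<close>; for \<open>\<rho> = 2\<close> it is the endpoint \<open>C\<close>,
  where the derivative is one-sided.\<close>

theorem corollary2:
  fixes C :: nat and \<rho> lam \<alpha> :: real
    and D :: "('x \<times> real) measure"
    and p :: "real \<Rightarrow> real"
  assumes "2 \<le> C" and "1 < \<rho>"
    and "lam = ln \<rho> / (real C - 1)"
    and "p = longtail_prior lam (real C)"
    and "prob_space D"
    and "distributed D lborel snd (\<lambda>y. ennreal (p y))"
    and "0 \<le> \<alpha>" and "\<alpha> \<le> 1"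
  shows "(\<alpha> < 1 \<longrightarrow>
            mixup_class_law p D \<alpha> UNIV = density lborel (\<lambda>y. ennreal (mixup_density p \<alpha> y)))
       \<and> mixup_class_law p D \<alpha> {(yi, yj). yj < yi} = density lborel (\<lambda>y. ennreal (mixup_density p \<alpha> y))
       \<and> (\<forall>y\<in>{1..real C}.
            mixup_density p \<alpha> y =
              lam / (exp (- lam) - exp (- lam * real C))\<^sup>2 * (exp (- lam * (y + 1)) - exp (- 2 * lam * y)))
       \<and> (2 \<le> \<rho> \<longrightarrow>
            (\<exists>m\<in>{1..real C}. (mixup_density p \<alpha> has_real_derivative 0) (at m within {1..real C})))
       \<and> (2 < \<rho> \<longrightarrow> middle_majority (real C) (mixup_density p \<alpha>))"
proof -
  have C: "1 < real C" and lam: "0 < lam"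
    using assms(1-3) by auto
  define K where "K = lam / (exp (- lam) - exp (- lam * real C))\<^sup>2"
  let ?q = "\<lambda>y. K * (exp (- lam * (y + 1)) - exp (- 2 * lam * y))"
  have K: "0 < K"
    using lam C by (simp add: K_def)
  note p = assms(4)
  have p_meas: "p \<in> borel_measurable borel" and p_nonneg: "0 \<le> p y" for y
    using borel_measurable_longtail_prior[OF lam C] longtail_prior_nonneg[OF lam C] by (simp_all add: p)
  have law: "mixup_class_law p D \<alpha> A = density lborel (\<lambda>y. ennreal (mixup_density p \<alpha> y))"
    if "A \<in> sets (lborel \<Otimes>\<^sub>M lborel)"
      "\<And>y z. 0 < p y \<Longrightarrow> 0 < p z \<Longrightarrow> y \<noteq> z \<Longrightarrow>
        (y, z) \<in> A \<and> counts_as_first p \<alpha> y z \<longleftrightarrow> z < y \<and> counts_as_first p \<alpha> y z" for A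
    using assms(5,6) p_meas p_nonneg assms(7) that by (rule mixup_class_law_eq)
  have law_UNIV: "mixup_class_law p D \<alpha> UNIV = density lborel (\<lambda>y. ennreal (mixup_density p \<alpha> y))" if "\<alpha> < 1"
  proof (rule law)
    have "space (lborel \<Otimes>\<^sub>M lborel :: (real \<times> real) measure) = UNIV"
      by (simp add: space_pair_measure)
    then show "(UNIV :: (real \<times> real) set) \<in> sets (lborel \<Otimes>\<^sub>M lborel)"
      using sets.top by metis
    fix y z assume yz: "0 < p y" "0 < p z" "y \<noteq> z"
    \<comment> \<open>A later class is rarer, which puts the mean strictly below 1/2.\<close>
    have "\<not> counts_as_first p \<alpha> y z" if "y < z"
    proof -
      have "p z < p y"
        using yz that monotone_onD[OF longtail_prior_strict_antimono[OF lam C], of y z]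
        by (simp add: p longtail_prior_pos_iff[OF lam C])
      then show ?thesis
        using unimix_mean_less_half[OF assms(7) \<open>\<alpha> < 1\<close> yz(2)] by (simp add: counts_as_first_def not_le)
    qed
    then show "(y, z) \<in> UNIV \<and> counts_as_first p \<alpha> y z \<longleftrightarrow> z < y \<and> counts_as_first p \<alpha> y z"
      using yz(3) by (metis UNIV_I linorder_neqE_linordered_idom)
  qed
  have law_less: "mixup_class_law p D \<alpha> {(yi, yj). yj < yi} = density lborel (\<lambda>y. ennreal (mixup_density p \<alpha> y))"
  proof (rule law)
    have "{w \<in> space (lborel \<Otimes>\<^sub>M lborel). snd w < (fst w :: real)} \<in> sets (lborel \<Otimes>\<^sub>M lborel)"
      by measurable
    also have "{w \<in> space (lborel \<Otimes>\<^sub>M lborel). snd w < (fst w :: real)} = {(yi, yj). yj < yi}"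
      by (auto simp: space_pair_measure)
    finally show "{(yi, yj). yj < (yi :: real)} \<in> sets (lborel \<Otimes>\<^sub>M lborel)" .
  qed auto
  have formula: "mixup_density p \<alpha> y = ?q y" if "y \<in> {1..real C}" for y
    using mixup_density_longtail_prior[OF lam C assms(7,8)] that by (simp add: p K_def)
  \<comment> \<open>The solution of \<open>exp (- lam * m) = exp (- lam) / 2\<close>, the vertex of
    the parabola.\<close>
  define m where "m = 1 + ln 2 / lam"
  have m: "exp (- lam * m) = exp (- lam) / 2"
    using lam by (simp add: m_def ring_distribs exp_diff exp_minus)
  \<comment> \<open>With \<open>lam = ln \<rho> / (C - 1)\<close> the bound reduces to
    \<open>ln 2 \<le> ln \<rho>\<close>.\<close>
  have m_le: "m \<le> real C" if "2 \<le> \<rho>"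
    using that assms(2) C mult_right_mono[of "ln 2" "ln \<rho>" "real C - 1"] by (simp add: m_def assms(3) field_simps)
  have m_less: "m < real C" if "2 < \<rho>"
    using that assms(2) C mult_strict_right_mono[of "ln 2" "ln \<rho>" "real C - 1"] by (simp add: m_def assms(3) field_simps)
  have m_gt: "1 < m"
    using lam by (simp add: m_def)
  have deriv: "(mixup_density p \<alpha> has_real_derivative 0) (at m within {1..real C})" if "2 \<le> \<rho>"
  proof (rule has_field_derivative_transform_within[OF has_real_derivative_exp_profile[OF m] zero_less_one])
    show "m \<in> {1..real C}"
      using m_gt m_le[OF that] by simp
    show "?q y = mixup_density p \<alpha> y" if "y \<in> {1..real C}" for y
      using formula[OF that] by simp
  qed
  have mid: "middle_majority (real C) (mixup_density p \<alpha>)" if "2 < \<rho>"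
    unfolding middle_majority_def
  proof (intro exI[of _ m] conjI m_gt m_less[OF that])
    show "(mixup_density p \<alpha> has_real_derivative 0) (at m)"
      using deriv that m_gt m_less[OF that] by (simp add: at_within_Icc_at)
    show "strict_mono_on {1..m} (mixup_density p \<alpha>)"
      using monotone_onD[OF exp_profile_strict_mono[OF lam K m]] m_less[OF that]
      by (intro monotone_onI) (simp add: formula)
    show "strict_antimono_on {m..real C} (mixup_density p \<alpha>)"
      using monotone_onD[OF exp_profile_strict_antimono[OF lam K m]] m_gt
      by (intro monotone_onI) (simp add: formula)
  qed
  have "m \<in> {1..real C}" if "2 \<le> \<rho>"
    using m_gt m_le[OF that] by simp
  with law_UNIV law_less formula deriv mid show ?thesis
    unfolding K_def by blast
qed

end
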